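(* Let $n$ be a non-zero natural number and let $\mathbf X$ be an $n$-topological space, i.e. a set $X$ endowed with topologies $\tau_0\subset\tau_1\subset\dots\subset\tau_{n-1}$. Then the Kuratowski monoid $\mathsf K(\mathbf X)$ has cardinality $|\mathsf K(\mathbf X)|\le K(n)$ and the full Kuratowski monoid $\mathsf K_2(\mathbf X)$ has cardinality $|\mathsf K_2(\mathbf X)|\le 2\cdot K(n)$, where $K(n)=\sum_{i,j=0}^{n}\binom{i+j}{i}\binom{i+j}{j}$.
   Context: For a set $X$, $\mathcal P(X)$ is its power-set and $\mathcal P(X)^{\mathcal P(X)}$ is the monoid (under composition) of all self-maps of $\mathcal P(X)$. For a topology $\tau$ on $X$, $\breve\tau,\bar\tau:\mathcal P(X)\to\mathcal P(X)$ denote the operators of taking the interior and the closure with respect to $\tau$; $c:\mathcal P(X)\to\mathcal P(X)$, $c(A)=X\setminus A$, is the complement operator. An $n$-topological space is a set $X$ with a monotone sequence of topologies $\tau_0\subset\tau_1\subset\dots\subset\tau_{n-1}$ (not necessarily distinct). Its Kuratowski monoid $\mathsf K(\mathbf X)$ is the submonoid of $\mathcal P(X)^{\mathcal P(X)}$ (containing the identity) generated by all $\breve\tau_i,\bar\tau_i$, $i<n$; its full Kuratowski monoid $\mathsf K_2(\mathbf X)$ is the submonoid generated by $c$ and all $\bar\tau_i$, $i<n$. *)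

theory Defs
  imports "HOL-Analysis.Analysis" "HOL-Algebra.Group"
begin

text \<open>
  Self-maps of \<open>Pow X\<close> are represented by extensional functions (value \<open>undefined\<close> outside
  \<open>Pow X\<close>), so that two of them are equal iff they agree on all subsets of \<open>X\<close>; hence every
  operator below is restricted to \<open>Pow X\<close>.
\<close>

definition powerset_maps :: "'a set \<Rightarrow> ('a set \<Rightarrow> 'a set) monoid" where
  "powerset_maps X =
     \<lparr>carrier = Pow X \<rightarrow>\<^sub>E Pow X,
      mult = (\<lambda>g f. compose (Pow X) g f),
      one = (\<lambda>A\<in>Pow X. A)\<rparr>"

inductive_set submonoid_generated :: "('a, 'b) monoid_scheme \<Rightarrow> 'a set \<Rightarrow> 'a set"
  for M and S where
    one: "\<one>\<^bsub>M\<^esub> \<in> submonoid_generated M S"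
  | incl: "s \<in> S \<Longrightarrow> s \<in> submonoid_generated M S"
  | mult: "f \<in> submonoid_generated M S \<Longrightarrow> g \<in> submonoid_generated M S
           \<Longrightarrow> f \<otimes>\<^bsub>M\<^esub> g \<in> submonoid_generated M S"

definition interior_map :: "'a topology \<Rightarrow> 'a set \<Rightarrow> 'a set" where
  "interior_map T = (\<lambda>A\<in>Pow (topspace T). T interior_of A)"

definition closure_map :: "'a topology \<Rightarrow> 'a set \<Rightarrow> 'a set" where
  "closure_map T = (\<lambda>A\<in>Pow (topspace T). T closure_of A)"

definition complement_map :: "'a set \<Rightarrow> 'a set \<Rightarrow> 'a set" where
  "complement_map X = (\<lambda>A\<in>Pow X. X - A)"

text \<open>Only the values \<open>\<tau> i\<close> with \<open>i < n\<close> matter; the topologies need not be distinct.\<close>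

definition n_topological_space :: "nat \<Rightarrow> 'a set \<Rightarrow> (nat \<Rightarrow> 'a topology) \<Rightarrow> bool" where
  "n_topological_space n X \<tau> \<longleftrightarrow>
     (\<forall>i<n. topspace (\<tau> i) = X) \<and>
     (\<forall>i j. i \<le> j \<and> j < n \<longrightarrow> {U. openin (\<tau> i) U} \<subseteq> {U. openin (\<tau> j) U})"

definition Kuratowski_monoid ::
    "nat \<Rightarrow> 'a set \<Rightarrow> (nat \<Rightarrow> 'a topology) \<Rightarrow> ('a set \<Rightarrow> 'a set) set" where
  "Kuratowski_monoid n X \<tau> =
     submonoid_generated (powerset_maps X)
       ((\<lambda>i. interior_map (\<tau> i)) ` {..<n} \<union> (\<lambda>i. closure_map (\<tau> i)) ` {..<n})"

definition full_Kuratowski_monoid ::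
    "nat \<Rightarrow> 'a set \<Rightarrow> (nat \<Rightarrow> 'a topology) \<Rightarrow> ('a set \<Rightarrow> 'a set) set" where
  "full_Kuratowski_monoid n X \<tau> =
     submonoid_generated (powerset_maps X)
       (insert (complement_map X) ((\<lambda>i. closure_map (\<tau> i)) ` {..<n}))"

definition Kuratowski_number :: "nat \<Rightarrow> nat" where
  "Kuratowski_number n = (\<Sum>i=0..n. \<Sum>j=0..n. ((i + j) choose i) * ((i + j) choose j))"

lemma monoid_powerset_maps: "monoid (powerset_maps X)"
proof (rule monoidI)
  fix f g h
  assume "f \<in> carrier (powerset_maps X)" "g \<in> carrier (powerset_maps X)"
    "h \<in> carrier (powerset_maps X)"
  then have "h \<in> Pow X \<rightarrow> Pow X"
    by (auto simp: powerset_maps_def)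
  from compose_assoc[OF this, of f g]
  show "f \<otimes>\<^bsub>powerset_maps X\<^esub> g \<otimes>\<^bsub>powerset_maps X\<^esub> h
      = f \<otimes>\<^bsub>powerset_maps X\<^esub> (g \<otimes>\<^bsub>powerset_maps X\<^esub> h)"
    by (simp add: powerset_maps_def)
next
  fix f assume "f \<in> carrier (powerset_maps X)"
  then have f: "f \<in> Pow X \<rightarrow> Pow X" "f \<in> extensional (Pow X)"
    by (auto simp: powerset_maps_def PiE_def)
  show "\<one>\<^bsub>powerset_maps X\<^esub> \<otimes>\<^bsub>powerset_maps X\<^esub> f = f"
    using Id_compose[OF f] by (simp add: powerset_maps_def)
  show "f \<otimes>\<^bsub>powerset_maps X\<^esub> \<one>\<^bsub>powerset_maps X\<^esub> = f"
    using compose_Id[OF f] by (simp add: powerset_maps_def)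
qed (auto simp: powerset_maps_def compose_def PiE_def Pi_def extensional_def)

lemma maps_in_carrier:
  "interior_map T \<in> carrier (powerset_maps (topspace T))"
  "closure_map T \<in> carrier (powerset_maps (topspace T))"
  "complement_map X \<in> carrier (powerset_maps X)"
  using interior_of_subset_topspace closure_of_subset_topspace
  by (fastforce simp: powerset_maps_def interior_map_def closure_map_def complement_map_def)+

lemma submonoid_generated_submonoid:
  assumes "monoid M" "S \<subseteq> carrier M"
  shows "submonoid (submonoid_generated M S) M"
proof
  interpret monoid M by fact
  show "submonoid_generated M S \<subseteq> carrier M"
  proof
    fix x assume "x \<in> submonoid_generated M S"
    then show "x \<in> carrier M"
      by induction (use assms(2) in auto)
  qed
qed (auto intro: submonoid_generated.intros)

lemma submonoid_generated_least:
  assumes "submonoid H M" "S \<subseteq> H"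
  shows "submonoid_generated M S \<subseteq> H"
proof
  fix x assume "x \<in> submonoid_generated M S"
  then show "x \<in> H"
    by induction (use assms in \<open>auto simp: submonoid_def\<close>)
qed

end

theory Submission
  imports Defs
begin

text \<open>
  Write \<open>C\<^sub>k\<close> and \<open>I\<^sub>k\<close> for closure and interior in \<open>\<tau> (n - k)\<close>, and \<open>C\<^sub>0 = I\<^sub>0 = id\<close>. A larger
  strength \<open>k\<close> means a coarser topology, hence a larger closure and a smaller interior, so that
  \<open>I\<^sub>n \<le> \<dots> \<le> I\<^sub>1 \<le> id \<le> C\<^sub>1 \<le> \<dots> \<le> C\<^sub>n\<close> is a chain of monotone idempotents.
  Composing operators of the same kind, the stronger one wins. For mixed words
  the only law is the sandwich (lemma \<open>sandwich\<close>): if no letter of \<open>w\<close> is stronger than the one of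
  its own kind among \<open>C\<^sub>b\<close>, \<open>I\<^sub>k\<close>, then \<open>C\<^sub>b w I\<^sub>k = C\<^sub>b I\<^sub>k\<close> and \<open>I\<^sub>k w C\<^sub>b = I\<^sub>k C\<^sub>b\<close>. For the first
  equation, \<open>w\<close> is at most \<open>C\<^sub>b\<close>, which the left factor absorbs, and at least \<open>I\<^sub>k\<close>, which the right
  factor absorbs.

  The sandwich law forces the strengths of each kind in a reduced word to rise and then to fall. A rising half
  is a lattice path from \<open>(0,0)\<close> to a point \<open>(i,j)\<close>: a step in the first direction which arrives at
  coordinate \<open>k\<close> is the letter \<open>C\<^sub>k\<close>, a step in the second direction the letter \<open>I\<^sub>k\<close>, and a straight
  run of steps collapses to its last letter. A falling half is such a path read backwards. Every
  word equals a rising path times a falling path with the same end point (lemma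
  \<open>word_is_path_product\<close>), because these products are stable under right multiplication by a letter.
  Let the letter be \<open>I\<^sub>k\<close>. If \<open>k\<close> is at least the current \<open>I\<close>-strength of the peak, then \<open>I\<^sub>k\<close>
  swallows the whole falling half; otherwise only the part of the falling half below the
  step from \<open>k\<close> to \<open>k + 1\<close> changes, and it shrinks to \<open>C\<^sub>m I\<^sub>k\<close>,
  where \<open>m\<close> is the other coordinate of that step.

  There are \<open>(i + j) choose i\<close> lattice paths to \<open>(i,j)\<close>, and this number is also \<open>(i + j) choose j\<close>;
  so the pairs of paths with a common end point in \<open>{0..n} \<times> {0..n}\<close> are counted by the Kuratowski
  number. Finally, passing the complement from one side of a word to the other swaps closures and
  interiors, so that the full monoid is the union of the Kuratowski monoid and its right translate
  by the complement.
\<close>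

section \<open>Words and lattice paths\<close>

text \<open>
  A lattice path is a list of steps whose \<^emph>\<open>last\<close> step comes first, so that extending a path is
  \<open>Cons\<close> and \<open>count_list\<close> gives its end point. \<open>True\<close> stands for closures, \<open>False\<close> for interiors. Each
  step becomes a letter whose strength is the coordinate at which the step arrives; \<open>path_word\<close> thus
  reads a falling half from left to right, and its reverse is a rising half.
\<close>
fun path_word :: "bool list \<Rightarrow> (bool \<times> nat) list" where
  "path_word [] = []"
| "path_word (s # p) = (s, Suc (count_list p s)) # path_word p"

lemma path_word_bounded: "(t, j) \<in> set (path_word p) \<Longrightarrow> j \<le> count_list p t"
  by (induction p) auto

definition paths_to :: "nat \<Rightarrow> nat \<Rightarrow> bool list set" where
  "paths_to i j = {p. count_list p True = i \<and> count_list p False = j}"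

lemma length_eq_count_sum: "length (p :: bool list) = count_list p True + count_list p False"
  by (induction p) auto

lemma finite_paths_to: "finite (paths_to i j)"
proof (rule finite_subset)
  show "paths_to i j \<subseteq> {p. set p \<subseteq> UNIV \<and> length p = i + j}"
    by (auto simp: paths_to_def length_eq_count_sum)
  show "finite {p :: bool list. set p \<subseteq> UNIV \<and> length p = i + j}"
    by (rule finite_lists_length_eq) simp
qed

lemma paths_to_Suc_Suc:
  "paths_to (Suc i) (Suc j) =
     Cons True ` paths_to i (Suc j) \<union> Cons False ` paths_to (Suc i) j"
proof -
  have "p \<in> paths_to (Suc i) (Suc j) \<longleftrightarrow>
      p \<in> Cons True ` paths_to i (Suc j) \<union> Cons False ` paths_to (Suc i) j" for p
    by (cases p) (auto simp: paths_to_def image_iff)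
  then show ?thesis by blast
qed

lemma count_list_replicate: "count_list (replicate k t) s = (if t = s then k else 0)"
  by (induction k) auto

lemma paths_to_straight:
  "paths_to i 0 = {replicate i True}" "paths_to 0 j = {replicate j False}"
proof -
  have straight: "p = replicate (count_list p s) s" if "count_list p (\<not> s) = 0" for p s
  proof (rule replicate_eqI)
    show "length p = count_list p s"
      using that by (cases s) (simp_all add: length_eq_count_sum)
    show "y = s" if "y \<in> set p" for y
      using that \<open>count_list p (\<not> s) = 0\<close> by (cases "y = s") (auto simp: count_list_0_iff)
  qed
  show "paths_to i 0 = {replicate i True}" "paths_to 0 j = {replicate j False}"
    using straight[of _ True] straight[of _ False]
    by (auto simp: paths_to_def count_list_replicate)
qed

lemma card_paths_to: "card (paths_to i j) = (i + j) choose i"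
proof (induction "i + j" arbitrary: i j)
  case 0
  then show ?case by (simp add: paths_to_straight)
next
  case (Suc m)
  show ?case
  proof (cases "i = 0 \<or> j = 0")
    case True
    then show ?thesis by (auto simp: paths_to_straight)
  next
    case False
    then obtain i' j' where ij: "i = Suc i'" "j = Suc j'"
      by (metis not0_implies_Suc)
    have "card (paths_to i j) = card (paths_to i' j) + card (paths_to i j')"
      unfolding ij paths_to_Suc_Suc
      by (subst card_Un_disjoint) (auto simp: finite_paths_to card_image)
    also have "\<dots> = ((i' + j) choose i') + ((i + j') choose i)"
      using Suc ij by simp
    also have "\<dots> = (i + j) choose i"
      by (simp add: ij)
    finally show ?thesis .
  qed
qed

text \<open>
  The path \<open>q\<close> first follows \<open>v\<close> to the last point with coordinate \<open>k\<close> in direction \<open>s\<close>, and then steps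
  to \<open>k + 1\<close>.
\<close>
lemma split_at_count:
  assumes "k < count_list q s"
  shows "\<exists>u v. q = u @ s # v \<and> count_list v s = k"
  using assms
proof (induction q)
  case (Cons t q)
  show ?case
  proof (cases "k < count_list q s")
    case True
    with Cons.IH show ?thesis by (metis append_Cons)
  next
    case False
    with Cons.prems have "t = s" "count_list q s = k" by (auto split: if_splits)
    then show ?thesis by (metis append_Nil)
  qed
qed simp

section \<open>Two opposite chains of monotone idempotents\<close>

text \<open>
  Both chains are indexed by one function with a Boolean argument, so that each statement about a
  letter \<open>g s k\<close> also covers its order dual. Starting both chains at the identity makes
  extensivity of the upper chain and contractivity of the lower chain instances of monotonicity in
  the strength, and spares case distinctions when one kind of letter is absent.
\<close>
locale opposite_chains =
  fixes g :: "bool \<Rightarrow> nat \<Rightarrow> 'b::order \<Rightarrow> 'b"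
  assumes mono_g: "x \<le> y \<Longrightarrow> g s k x \<le> g s k y"
    and idem_g: "g s k (g s k x) = g s k x"
    and upper_chain: "j \<le> k \<Longrightarrow> g True j x \<le> g True k x"
    and lower_chain: "j \<le> k \<Longrightarrow> g False k x \<le> g False j x"
    and g_0: "g s 0 x = x"
begin

lemma upper_ge: "x \<le> g True k x"
  using upper_chain[of 0 k x] by (simp add: g_0)

lemma lower_le: "g False k x \<le> x"
  using lower_chain[of 0 k x] by (simp add: g_0)

lemma absorb:
  assumes "j \<le> k"
  shows "g s j (g s k x) = g s k x" "g s k (g s j x) = g s k x"
proof -
  show "g s j (g s k x) = g s k x"
    using upper_chain[OF assms, of "g True k x"] upper_ge[of "g True k x" j]
      lower_chain[OF assms, of "g False k x"] lower_le[of j "g False k x"]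
    by (cases s) (auto simp: idem_g intro: order.antisym)
  show "g s k (g s j x) = g s k x"
    using mono_g[OF upper_chain[OF assms], of True k x] mono_g[OF upper_ge, of True k x j]
      mono_g[OF lower_chain[OF assms], of False k x] mono_g[OF lower_le, of False k j x]
    by (cases s) (auto simp: idem_g intro: order.antisym)
qed

fun eval_word :: "(bool \<times> nat) list \<Rightarrow> 'b \<Rightarrow> 'b" where
  "eval_word [] x = x"
| "eval_word ((s, k) # w) x = g s k (eval_word w x)"

lemma eval_append: "eval_word (u @ v) x = eval_word u (eval_word v x)"
  by (induction u) auto

text \<open>
  Letters of the lower chain only decrease a value and those of the upper chain are absorbed by
  \<open>g True (h True)\<close>; dually for the lower bound. Applying the outer letters of
  the word \<open>g (\<not> s) (h (\<not> s)) w g s (h s)\<close> to these bounds gives the sandwich law.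
\<close>
lemma word_between:
  assumes "\<And>t j. (t, j) \<in> set w \<Longrightarrow> j \<le> h t"
  shows "g False (h False) x \<le> eval_word w x" "eval_word w x \<le> g True (h True) x"
proof -
  have "g False (h False) x \<le> eval_word w x \<and> eval_word w x \<le> g True (h True) x"
    using assms
  proof (induction w)
    case Nil
    then show ?case by (simp add: upper_ge lower_le)
  next
    case (Cons l w)
    obtain t j where l: "l = (t, j)" by force
    have j: "j \<le> h t" using Cons.prems l by simp
    have IH: "g False (h False) x \<le> eval_word w x" "eval_word w x \<le> g True (h True) x"
      using Cons by auto
    show ?case
    proof (cases t)
      case True
      have "g True j (eval_word w x) \<le> g True (h True) x"
        using mono_g[OF IH(2), of True j] j True by (simp add: absorb)
      with IH(1) show ?thesis
        using upper_ge[of "eval_word w x" j] l True by (auto intro: order.trans)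
    next
      case False
      have "g False (h False) x \<le> g False j (eval_word w x)"
        using mono_g[OF IH(1), of False j] j False by (simp add: absorb)
      with IH(2) show ?thesis
        using lower_le[of j "eval_word w x"] l False by (auto intro: order.trans)
    qed
  qed
  then show "g False (h False) x \<le> eval_word w x" "eval_word w x \<le> g True (h True) x"
    by auto
qed

lemma sandwich:
  assumes "\<And>t j. (t, j) \<in> set w \<Longrightarrow> j \<le> h t"
  shows "g (\<not> s) (h (\<not> s)) (eval_word w (g s (h s) x)) = g (\<not> s) (h (\<not> s)) (g s (h s) x)"
proof (rule order.antisym)
  let ?y = "g s (h s) x"
  note between = word_between[of w h, OF assms]
  have up: "g True (h True) (eval_word w ?y) \<le> g True (h True) ?y"
    and dn: "g False (h False) ?y \<le> g False (h False) (eval_word w ?y)"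
    using mono_g[OF between(2)[of ?y], of True "h True"]
      mono_g[OF between(1)[of ?y], of False "h False"]
    by (simp_all add: idem_g)
  show "g (\<not> s) (h (\<not> s)) (eval_word w ?y) \<le> g (\<not> s) (h (\<not> s)) ?y"
    using up mono_g[OF between(2)[of ?y], of False "h False"]
    by (cases s) (auto simp: idem_g)
  show "g (\<not> s) (h (\<not> s)) ?y \<le> g (\<not> s) (h (\<not> s)) (eval_word w ?y)"
    using dn mono_g[OF between(1)[of ?y], of True "h True"]
    by (cases s) (auto simp: idem_g)
qed

text \<open>
  Let \<open>p\<close> end at \<open>(i,j)\<close>. Its last step of kind \<open>\<not> s\<close> gives the strongest such letter; all that
  stands between this letter and the final \<open>g s (h s)\<close>, namely the later steps of \<open>p\<close> and the word \<open>w\<close>,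
  is removed by the sandwich law. The induction therefore moves the steps of kind \<open>s\<close> into \<open>w\<close>
  until a step of kind \<open>\<not> s\<close> is met.
\<close>
lemma ascending_path_swallows:
  assumes "\<And>t. count_list p t \<le> h t" "h (\<not> s) = count_list p (\<not> s)"
    and "\<And>t j. (t, j) \<in> set w \<Longrightarrow> j \<le> h t"
  shows "eval_word (rev (path_word p)) (eval_word w (g s (h s) x))
       = eval_word (rev (path_word p)) (g s (h s) x)"
  using assms
proof (induction p arbitrary: w)
  case Nil
  then show ?case using sandwich[of w h s x] by (simp add: g_0)
next
  case (Cons t p)
  let ?c = "Suc (count_list p t)"
  have c: "?c \<le> h t" using Cons.prems(1)[of t] by simp
  have le: "count_list p t' \<le> h t'" for t'
    using Cons.prems(1)[of t'] by (simp split: if_splits)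
  show ?case
  proof (cases "t = s")
    case True
    then have eq: "h (\<not> s) = count_list p (\<not> s)" using Cons.prems(2) by simp
    have "eval_word (rev (path_word p)) (eval_word ((t, ?c) # w) (g s (h s) x))
        = eval_word (rev (path_word p)) (g s (h s) x)"
      by (rule Cons.IH[OF le eq]) (use c Cons.prems(3) in auto)
    moreover have "eval_word (rev (path_word p)) (eval_word [(t, ?c)] (g s (h s) x))
        = eval_word (rev (path_word p)) (g s (h s) x)"
      by (rule Cons.IH[OF le eq]) (use c in auto)
    ultimately show ?thesis by (simp add: eval_append)
  next
    case False
    then have t: "t = (\<not> s)" by simp
    then have "?c = h (\<not> s)" using Cons.prems(2) by simp
    then show ?thesis
      using sandwich[of w h s x, OF Cons.prems(3)] t by (simp add: eval_append)
  qed
qed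

text \<open>
  Below the peak, the topmost letters of kind \<open>s\<close> in \<open>q\<close> are absorbed by \<open>g s k'\<close>, the
  next letter has kind \<open>\<not> s\<close> and is the strongest of its kind, and the sandwich law removes the
  rest. In this context only the end point of \<open>q\<close> remains visible, so \<open>q\<close> may be replaced by any other path to that
  point.
\<close>
lemma descending_path_between:
  assumes "count_list q s \<le> k" "k \<le> k'"
  shows "g s k' (eval_word (path_word q) (g s k x))
       = g s k' (g (\<not> s) (count_list q (\<not> s)) (g s k x))"
  using assms(1)
proof (induction q)
  case Nil
  then show ?case by (simp add: g_0)
next
  case (Cons t q)
  show ?case
  proof (cases "t = s")
    case True
    then show ?thesis using Cons assms(2) by (simp add: absorb)
  next
    case False
    then have t: "t = (\<not> s)" by simp
    let ?h = "(\<lambda>_. Suc (count_list q t))(s := k)"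
    have "j \<le> ?h t'" if "(t', j) \<in> set (path_word q)" for t' j
      using path_word_bounded[OF that] Cons.prems t by (cases "t' = s") auto
    from sandwich[of "path_word q" ?h s x, OF this] show ?thesis
      using t by simp
  qed
qed

lemma eval_path_congruence:
  assumes "\<And>t. count_list v t = count_list v' t"
    and "eval_word (path_word (r # v)) x = eval_word (path_word (r # v')) y"
  shows "eval_word (path_word (u @ r # v)) x = eval_word (path_word (u @ r # v')) y"
  using assms by (induction u) auto

lemma eval_straight_path: "eval_word (path_word (replicate k s)) x = g s k x"
  by (induction k) (auto simp: g_0 absorb count_list_replicate)

text \<open>
  A path that starts with \<open>k\<close> steps of kind \<open>s\<close> already contains the factor \<open>g s k\<close> at the right end
  of its word.
\<close>
lemma straight_start_absorbs:
  "eval_word (path_word (u @ replicate k s)) (g s k x) = eval_word (path_word (u @ replicate k s)) x"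
  by (induction u) (auto simp: eval_straight_path idem_g)

definition path_product :: "bool list \<Rightarrow> bool list \<Rightarrow> 'b \<Rightarrow> 'b" where
  "path_product p q x = eval_word (rev (path_word p)) (eval_word (path_word q) x)"

text \<open>
  The part of the falling half below the step from \<open>k\<close> to \<open>k + 1\<close> is rerouted so that it begins with
  \<open>k\<close> straight steps of kind \<open>s\<close>; then the new factor is absorbed.
\<close>
lemma path_product_mult_small:
  assumes k: "k < count_list q s"
  shows "\<exists>q'. (\<forall>t. count_list q' t = count_list q t)
            \<and> (\<forall>x. path_product p q (g s k x) = path_product p q' x)"
proof -
  obtain u v where q: "q = u @ s # v" and v: "count_list v s = k"
    using split_at_count[OF k] by blast
  define v' where "v' = replicate (count_list v (\<not> s)) (\<not> s) @ replicate k s"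
  have v': "count_list v' t = count_list v t" for t
    using v by (cases "t = s") (auto simp: v'_def count_list_replicate)
  have "eval_word (path_word (s # v)) (g s k x) = eval_word (path_word (s # v')) (g s k x)" for x
    using descending_path_between[of v s k "Suc k"] descending_path_between[of v' s k "Suc k"]
    by (simp add: v v')
  then have "eval_word (path_word (u @ s # v)) (g s k x)
      = eval_word (path_word (u @ s # v')) (g s k x)" for x
    by (intro eval_path_congruence) (simp_all add: v')
  also have "eval_word (path_word (u @ s # v')) (g s k x)
      = eval_word (path_word (u @ s # v')) x" for x
    using straight_start_absorbs[of "u @ s # replicate (count_list v (\<not> s)) (\<not> s)" k s x]
    by (simp add: v'_def)
  finally have "path_product p q (g s k x) = path_product p (u @ s # v') x" for x
    by (simp add: path_product_def q)
  moreover have "count_list (u @ s # v') t = count_list q t" for t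
    by (simp add: q v')
  ultimately show ?thesis by blast
qed

text \<open>
  The peak is moved to strength \<open>k\<close> in direction \<open>s\<close>. By \<open>ascending_path_swallows\<close>, whatever stands
  between the old rising half and \<open>g s k\<close> does not matter. So the old falling half may be exchanged
  for the added rising steps followed by a falling path that begins with \<open>k\<close> straight steps of kind \<open>s\<close>.
\<close>
lemma path_product_mult_large:
  assumes pq: "\<And>t. count_list p t = count_list q t" and k: "count_list q s \<le> k"
  shows "\<exists>p' q'. (\<forall>t. count_list p' t = count_list q' t
                     \<and> count_list p' t = (if t = s then k else count_list p t))
            \<and> (\<forall>x. path_product p q (g s k x) = path_product p' q' x)"
proof -
  define h where "h = (count_list p)(s := k)"
  define d where "d = k - count_list p s"
  define p' where "p' = replicate d s @ p"
  define q' where "q' = replicate (count_list p (\<not> s)) (\<not> s) @ replicate k s"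
  have h: "count_list p t \<le> h t" "h (\<not> s) = count_list p (\<not> s)" "h s = k" for t
    using k pq by (auto simp: h_def)
  have p': "count_list p' t = h t" for t
    using k pq by (auto simp: p'_def h_def d_def count_list_replicate)
  have q': "count_list q' t = h t" for t
    by (cases "t = s") (auto simp: q'_def h_def count_list_replicate)
  have q: "j \<le> h t" if "(t, j) \<in> set (path_word q)" for t j
    using path_word_bounded[OF that] h(1)[of t] pq by simp
  obtain z where z: "path_word p' = z @ path_word p"
    unfolding p'_def by (induction d) auto
  have zq': "j \<le> h t" if "(t, j) \<in> set (rev z @ path_word q')" for t j
    using path_word_bounded[of t j p'] path_word_bounded[of t j q'] that z p' q' by auto
  have "path_product p q (g s k x) = path_product p' q' x" for x
  proof -
    have "path_product p q (g s k x) = eval_word (rev (path_word p)) (g s k x)"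
      using ascending_path_swallows[of p h s "path_word q" x, OF h(1,2) q]
      by (simp add: path_product_def h(3))
    also have "\<dots> = eval_word (rev (path_word p)) (eval_word (rev z @ path_word q') (g s k x))"
      using ascending_path_swallows[of p h s "rev z @ path_word q'" x, OF h(1,2) zq']
      by (simp only: h(3))
    also have "\<dots> = path_product p' q' (g s k x)"
      by (simp add: path_product_def z eval_append)
    also have "\<dots> = path_product p' q' x"
      by (simp add: path_product_def q'_def straight_start_absorbs)
    finally show ?thesis .
  qed
  then show ?thesis using p' q' by (intro exI[of _ p'] exI[of _ q']) (auto simp: h_def)
qed

lemma word_is_path_product:
  assumes "\<And>t j. (t, j) \<in> set w \<Longrightarrow> j \<le> n"
  shows "\<exists>p q. (\<forall>t. count_list p t = count_list q t \<and> count_list p t \<le> n)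
            \<and> (\<forall>x. eval_word w x = path_product p q x)"
  using assms
proof (induction w rule: rev_induct)
  case Nil
  show ?case by (intro exI[of _ "[]"]) (simp add: path_product_def)
next
  case (snoc l w)
  obtain s k where l: "l = (s, k)" by force
  have k: "k \<le> n" using snoc.prems[of s k] l by simp
  obtain p q where pq: "\<And>t. count_list p t = count_list q t" "\<And>t. count_list p t \<le> n"
    and w: "\<And>x. eval_word w x = path_product p q x"
    using snoc by (metis UnCI set_append)
  have step: "eval_word (w @ [l]) x = path_product p q (g s k x)" for x
    by (simp add: eval_append w l)
  show ?case
  proof (cases "k < count_list q s")
    case True
    from path_product_mult_small[OF this] show ?thesis
      using pq step by metis
  next
    case False
    then have "count_list q s \<le> k" by simp
    from path_product_mult_large[OF pq(1) this] show ?thesis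
      using pq step k by metis
  qed
qed

end

section \<open>Counting pairs of paths\<close>

definition path_pairs :: "nat \<Rightarrow> (bool list \<times> bool list) set" where
  "path_pairs n = (\<Union>i\<in>{0..n}. \<Union>j\<in>{0..n}. paths_to i j \<times> paths_to i j)"

lemma finite_path_pairs: "finite (path_pairs n)"
  by (auto simp: path_pairs_def finite_paths_to)

lemma card_path_pairs_le: "card (path_pairs n) \<le> Kuratowski_number n"
proof -
  have "card (path_pairs n) \<le> (\<Sum>i=0..n. card (\<Union>j\<in>{0..n}. paths_to i j \<times> paths_to i j))"
    unfolding path_pairs_def by (rule card_UN_le) simp
  also have "\<dots> \<le> (\<Sum>i=0..n. \<Sum>j=0..n. card (paths_to i j \<times> paths_to i j))"
    by (intro sum_mono card_UN_le) simp
  also have "\<dots> = Kuratowski_number n"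
  proof -
    have "(i + j) choose j = (i + j) choose i" for i j :: nat
      using binomial_symmetric[of i "i + j"] by simp
    then show ?thesis
      by (simp add: Kuratowski_number_def card_paths_to card_cartesian_product)
  qed
  finally show ?thesis .
qed

section \<open>Interior and closure operators\<close>

text \<open>
  The union with \<open>A\<close> changes nothing for \<open>A \<subseteq> X\<close>. It makes the operator extensive on all sets, since
  \<open>closure_of\<close> discards the points outside the space; thus the operators form chains of total
  functions and words in them need no carrier conditions.
\<close>
definition strength_operator ::
    "nat \<Rightarrow> (nat \<Rightarrow> 'a topology) \<Rightarrow> bool \<Rightarrow> nat \<Rightarrow> 'a set \<Rightarrow> 'a set" where
  "strength_operator n \<tau> s k A =
     (if k = 0 then A
      else if s then A \<union> \<tau> (n - k) closure_of A
      else \<tau> (n - k) interior_of A)"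

lemma opposite_chains_strength_operator:
  assumes "n \<noteq> 0" "n_topological_space n X \<tau>"
  shows "opposite_chains (strength_operator n \<tau>)"
proof
  have X: "topspace (\<tau> i) = X" if "i < n" for i
    using assms(2) that by (simp add: n_topological_space_def)
  have sub: "openin (\<tau> j) U" if "openin (\<tau> i) U" "i \<le> j" "j < n" for i j U
    using assms(2) that unfolding n_topological_space_def by blast
  fix x y :: "'a set" and s :: bool and j k :: nat
  show "strength_operator n \<tau> s 0 x = x"
    by (simp add: strength_operator_def)
  show "strength_operator n \<tau> s k x \<subseteq> strength_operator n \<tau> s k y" if "x \<subseteq> y"
    using closure_of_mono[OF that, of "\<tau> (n - k)"] interior_of_mono[OF that, of "\<tau> (n - k)"] that
    by (auto simp: strength_operator_def)
  show "strength_operator n \<tau> s k (strength_operator n \<tau> s k x) = strength_operator n \<tau> s k x"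
    by (auto simp: strength_operator_def closure_of_Un)
  assume "j \<le> k"
  then have *: "n - k \<le> n - j" "j \<noteq> 0 \<Longrightarrow> n - j < n" using assms(1) by auto
  show "strength_operator n \<tau> True j x \<subseteq> strength_operator n \<tau> True k x"
  proof (cases "j = 0")
    case False
    then have "\<tau> (n - j) closure_of x \<subseteq> \<tau> (n - k) closure_of x"
      using * X[of "n - j"] X[of "n - k"] sub[of "n - k" _ "n - j"]
      by (auto simp: in_closure_of)
    then show ?thesis using False \<open>j \<le> k\<close> by (auto simp: strength_operator_def)
  qed (auto simp: strength_operator_def)
  show "strength_operator n \<tau> False k x \<subseteq> strength_operator n \<tau> False j x"
  proof (cases "j = 0")
    case True
    then show ?thesis
      using interior_of_subset[of "\<tau> (n - k)" x] by (auto simp: strength_operator_def)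
  next
    case False
    then have "\<tau> (n - k) interior_of x \<subseteq> \<tau> (n - j) interior_of x"
      using * sub[of "n - k" _ "n - j"] by (auto simp: interior_of_def)
    then show ?thesis using False \<open>j \<le> k\<close> by (auto simp: strength_operator_def)
  qed
qed

context
  fixes n :: nat and X :: "'a set" and \<tau> :: "nat \<Rightarrow> 'a topology"
  assumes n: "n \<noteq> 0" and nts: "n_topological_space n X \<tau>"
begin

interpretation opposite_chains "strength_operator n \<tau>"
  by (rule opposite_chains_strength_operator[OF n nts])

lemma topspace_eq: "i < n \<Longrightarrow> topspace (\<tau> i) = X"
  using nts by (simp add: n_topological_space_def)

lemma operator_in_Pow: "A \<subseteq> X \<Longrightarrow> strength_operator n \<tau> s k A \<subseteq> X"
  using closure_of_subset_topspace[of "\<tau> (n - k)" A] interior_of_subset[of "\<tau> (n - k)" A]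
    topspace_eq[of "n - k"] n
  by (auto simp: strength_operator_def)

lemma eval_word_in_Pow: "A \<subseteq> X \<Longrightarrow> eval_word w A \<subseteq> X"
  by (induction w) (auto dest: subsetD[OF operator_in_Pow])

lemma Kuratowski_monoid_words:
  assumes "f \<in> Kuratowski_monoid n X \<tau>"
  shows "\<exists>w. (\<forall>(t, j)\<in>set w. j \<le> n) \<and> f = restrict (eval_word w) (Pow X)"
  using assms unfolding Kuratowski_monoid_def
proof induction
  case one
  show ?case by (intro exI[of _ "[]"]) (auto simp: powerset_maps_def)
next
  case (incl f)
  then obtain i where i: "i < n" "f = interior_map (\<tau> i) \<or> f = closure_map (\<tau> i)" by auto
  have "interior_map (\<tau> i) = restrict (eval_word [(False, n - i)]) (Pow X)"
    unfolding interior_map_def topspace_eq[OF i(1)]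
    by (rule restrict_ext) (use i(1) in \<open>simp add: strength_operator_def\<close>)
  moreover have "closure_map (\<tau> i) = restrict (eval_word [(True, n - i)]) (Pow X)"
    unfolding closure_map_def topspace_eq[OF i(1)]
  proof (rule restrict_ext)
    fix A assume "A \<in> Pow X"
    then show "\<tau> i closure_of A = eval_word [(True, n - i)] A"
      using i(1) closure_of_subset[of A "\<tau> i"] topspace_eq[OF i(1)]
      by (simp add: strength_operator_def Un_absorb1)
  qed
  ultimately obtain s where "f = restrict (eval_word [(s, n - i)]) (Pow X)"
    using i(2) by blast
  then show ?case by (intro exI[of _ "[(s, n - i)]"] conjI) (simp, assumption)
next
  case (mult f h)
  then obtain u v where u: "\<forall>(t, j)\<in>set u. j \<le> n" "f = restrict (eval_word u) (Pow X)"
    and v: "\<forall>(t, j)\<in>set v. j \<le> n" "h = restrict (eval_word v) (Pow X)"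
    by blast
  have "f \<otimes>\<^bsub>powerset_maps X\<^esub> h = restrict (eval_word (u @ v)) (Pow X)"
    unfolding u(2) v(2) using eval_word_in_Pow
    by (auto simp: powerset_maps_def compose_def eval_append intro!: restrict_ext)
  then show ?case using u(1) v(1) by (intro exI[of _ "u @ v"]) auto
qed

lemma Kuratowski_monoid_path_products:
  "Kuratowski_monoid n X \<tau> \<subseteq> (\<lambda>(p, q). restrict (path_product p q) (Pow X)) ` path_pairs n"
proof
  fix f assume "f \<in> Kuratowski_monoid n X \<tau>"
  then obtain w where w: "\<forall>(t, j)\<in>set w. j \<le> n" "f = restrict (eval_word w) (Pow X)"
    using Kuratowski_monoid_words by blast
  have "\<exists>p q. (\<forall>t. count_list p t = count_list q t \<and> count_list p t \<le> n)
            \<and> (\<forall>x. eval_word w x = path_product p q x)"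
    by (rule word_is_path_product) (use w(1) in auto)
  then obtain p q where pq: "\<And>t. count_list p t = count_list q t \<and> count_list p t \<le> n"
    and eval: "\<And>x. eval_word w x = path_product p q x" by blast
  have "(p, q) \<in> path_pairs n"
    using pq[of True] pq[of False] by (auto simp: path_pairs_def paths_to_def)
  moreover have "f = restrict (path_product p q) (Pow X)"
    using w(2) eval by (simp add: restrict_def fun_eq_iff)
  ultimately show "f \<in> (\<lambda>(p, q). restrict (path_product p q) (Pow X)) ` path_pairs n"
    by force
qed

lemma finite_Kuratowski_monoid: "finite (Kuratowski_monoid n X \<tau>)"
  using Kuratowski_monoid_path_products finite_path_pairs finite_surj by blast

lemma card_Kuratowski_monoid_le: "card (Kuratowski_monoid n X \<tau>) \<le> Kuratowski_number n"
  using surj_card_le[OF finite_path_pairs Kuratowski_monoid_path_products]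
    card_path_pairs_le[of n] by simp

section \<open>Adjoining the complement\<close>

interpretation M: monoid "powerset_maps X"
  by (rule monoid_powerset_maps)

lemma generators_in_carrier:
  assumes "i < n"
  shows "interior_map (\<tau> i) \<in> carrier (powerset_maps X)"
    "closure_map (\<tau> i) \<in> carrier (powerset_maps X)"
  using maps_in_carrier(1,2)[of "\<tau> i"] topspace_eq[OF assms] by auto

lemma submonoid_Kuratowski: "submonoid (Kuratowski_monoid n X \<tau>) (powerset_maps X)"
  unfolding Kuratowski_monoid_def
  by (intro submonoid_generated_submonoid monoid_powerset_maps) (auto simp: generators_in_carrier)

lemmas Kuratowski_in_carrier = submonoid.mem_carrier[OF submonoid_Kuratowski]
lemmas Kuratowski_mult = submonoid.m_closed[OF submonoid_Kuratowski]
lemmas Kuratowski_one = submonoid.one_closed[OF submonoid_Kuratowski]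

lemma complement_involution:
  "complement_map X \<otimes>\<^bsub>powerset_maps X\<^esub> complement_map X = \<one>\<^bsub>powerset_maps X\<^esub>"
  by (auto simp: powerset_maps_def complement_map_def compose_def fun_eq_iff restrict_def)

lemma complement_interior:
  assumes "i < n"
  shows "complement_map X \<otimes>\<^bsub>powerset_maps X\<^esub> interior_map (\<tau> i)
       = closure_map (\<tau> i) \<otimes>\<^bsub>powerset_maps X\<^esub> complement_map X"
    "complement_map X \<otimes>\<^bsub>powerset_maps X\<^esub> closure_map (\<tau> i)
       = interior_map (\<tau> i) \<otimes>\<^bsub>powerset_maps X\<^esub> complement_map X"
proof -
  note X = topspace_eq[OF assms]
  have "X - \<tau> i interior_of A = \<tau> i closure_of (X - A)"
    "X - \<tau> i closure_of A = \<tau> i interior_of (X - A)" for A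
    using closure_of_complement[of "\<tau> i" A] interior_of_complement[of "\<tau> i" A] X by auto
  moreover have "\<tau> i interior_of A \<subseteq> X" "\<tau> i closure_of A \<subseteq> X" for A
    using interior_of_subset_topspace closure_of_subset_topspace X by metis+
  ultimately show "complement_map X \<otimes>\<^bsub>powerset_maps X\<^esub> interior_map (\<tau> i)
       = closure_map (\<tau> i) \<otimes>\<^bsub>powerset_maps X\<^esub> complement_map X"
    "complement_map X \<otimes>\<^bsub>powerset_maps X\<^esub> closure_map (\<tau> i)
       = interior_map (\<tau> i) \<otimes>\<^bsub>powerset_maps X\<^esub> complement_map X"
    unfolding complement_map_def interior_map_def closure_map_def X
    by (auto simp: powerset_maps_def compose_def intro!: restrict_ext)
qed

text \<open>
  Conjugation by the complement exchanges the two kinds of generators, hence preserves the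
  Kuratowski monoid.
\<close>
lemma complement_passes_through:
  assumes "f \<in> Kuratowski_monoid n X \<tau>"
  shows "\<exists>f'\<in>Kuratowski_monoid n X \<tau>.
      complement_map X \<otimes>\<^bsub>powerset_maps X\<^esub> f = f' \<otimes>\<^bsub>powerset_maps X\<^esub> complement_map X"
  using assms unfolding Kuratowski_monoid_def
proof induction
  case one
  show ?case
    using submonoid_generated.one maps_in_carrier(3)[of X] by (metis M.l_one M.r_one)
next
  case (incl f)
  then obtain i where i: "i < n" "f = interior_map (\<tau> i) \<or> f = closure_map (\<tau> i)" by auto
  have "interior_map (\<tau> i) \<in> Kuratowski_monoid n X \<tau>" "closure_map (\<tau> i) \<in> Kuratowski_monoid n X \<tau>"
    unfolding Kuratowski_monoid_def using i(1) by (auto intro!: submonoid_generated.incl)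
  then show ?case
    using i complement_interior[OF i(1)] unfolding Kuratowski_monoid_def by metis
next
  case (mult f h)
  note fold = Kuratowski_monoid_def[symmetric]
  note c = maps_in_carrier(3)[of X]
  from mult obtain f' h' where f': "f' \<in> Kuratowski_monoid n X \<tau>"
      "complement_map X \<otimes>\<^bsub>powerset_maps X\<^esub> f = f' \<otimes>\<^bsub>powerset_maps X\<^esub> complement_map X"
    and h': "h' \<in> Kuratowski_monoid n X \<tau>"
      "complement_map X \<otimes>\<^bsub>powerset_maps X\<^esub> h = h' \<otimes>\<^bsub>powerset_maps X\<^esub> complement_map X"
    unfolding fold by blast
  note car = Kuratowski_in_carrier[OF f'(1)] Kuratowski_in_carrier[OF h'(1)]
    Kuratowski_in_carrier[OF mult.hyps(1)[unfolded fold]]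
    Kuratowski_in_carrier[OF mult.hyps(2)[unfolded fold]]
  have "complement_map X \<otimes>\<^bsub>powerset_maps X\<^esub> (f \<otimes>\<^bsub>powerset_maps X\<^esub> h)
      = f' \<otimes>\<^bsub>powerset_maps X\<^esub> (complement_map X \<otimes>\<^bsub>powerset_maps X\<^esub> h)"
    by (metis M.m_assoc c car f'(2))
  also have "\<dots> = (f' \<otimes>\<^bsub>powerset_maps X\<^esub> h') \<otimes>\<^bsub>powerset_maps X\<^esub> complement_map X"
    by (simp add: h'(2) M.m_assoc c car)
  finally show ?case
    using Kuratowski_mult[OF f'(1) h'(1)] unfolding fold by blast
qed

text \<open>
  The right-hand side contains the generators and is closed under products, since a complement in
  the middle of a product can be moved to the right end, where two complements cancel.
\<close>
lemma full_Kuratowski_monoid_subset: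
  "full_Kuratowski_monoid n X \<tau> \<subseteq> Kuratowski_monoid n X \<tau> \<union>
     (\<lambda>f. f \<otimes>\<^bsub>powerset_maps X\<^esub> complement_map X) ` Kuratowski_monoid n X \<tau>"
  (is "_ \<subseteq> ?K \<union> ?Kc")
proof
  let ?c = "complement_map X"
  note c = maps_in_carrier(3)[of X]
  note car = Kuratowski_in_carrier
  fix f assume "f \<in> full_Kuratowski_monoid n X \<tau>"
  then show "f \<in> ?K \<union> ?Kc"
    unfolding full_Kuratowski_monoid_def
  proof induction
    case one
    show ?case using Kuratowski_one by simp
  next
    case (incl f)
    then consider "f = ?c" | i where "i < n" "f = closure_map (\<tau> i)" by auto
    then show ?case
    proof cases
      case 1
      then have "f = \<one>\<^bsub>powerset_maps X\<^esub> \<otimes>\<^bsub>powerset_maps X\<^esub> ?c" using c by simp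
      then show ?thesis using Kuratowski_one by blast
    next
      case 2
      then have "f \<in> ?K"
        unfolding Kuratowski_monoid_def by (auto intro!: submonoid_generated.incl)
      then show ?thesis by simp
    qed
  next
    case (mult f h)
    obtain f0 where f0: "f0 \<in> ?K" "f = f0 \<or> f = f0 \<otimes>\<^bsub>powerset_maps X\<^esub> ?c"
      using mult.IH(1) by blast
    have left: "f0 \<otimes>\<^bsub>powerset_maps X\<^esub> y \<in> ?K \<union> ?Kc" if y: "y \<in> ?K \<union> ?Kc" for y
    proof -
      obtain y0 where y0: "y0 \<in> ?K" "y = y0 \<or> y = y0 \<otimes>\<^bsub>powerset_maps X\<^esub> ?c"
        using y by blast
      have "f0 \<otimes>\<^bsub>powerset_maps X\<^esub> y0 \<in> ?K"
        "f0 \<otimes>\<^bsub>powerset_maps X\<^esub> (y0 \<otimes>\<^bsub>powerset_maps X\<^esub> ?c)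
          = (f0 \<otimes>\<^bsub>powerset_maps X\<^esub> y0) \<otimes>\<^bsub>powerset_maps X\<^esub> ?c"
        using Kuratowski_mult f0(1) y0(1) by (simp_all add: M.m_assoc car c)
      then show ?thesis using y0(2) by blast
    qed
    have ch: "?c \<otimes>\<^bsub>powerset_maps X\<^esub> h \<in> ?K \<union> ?Kc"
    proof -
      obtain h0 where h0: "h0 \<in> ?K" "h = h0 \<or> h = h0 \<otimes>\<^bsub>powerset_maps X\<^esub> ?c"
        using mult.IH(2) by blast
      obtain h' where h': "h' \<in> ?K" "?c \<otimes>\<^bsub>powerset_maps X\<^esub> h0 = h' \<otimes>\<^bsub>powerset_maps X\<^esub> ?c"
        using complement_passes_through[OF h0(1)] by blast
      have "?c \<otimes>\<^bsub>powerset_maps X\<^esub> (h0 \<otimes>\<^bsub>powerset_maps X\<^esub> ?c) = h'"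
        using h' complement_involution car[OF h0(1)] car[OF h'(1)] c
        by (metis M.m_assoc M.r_one)
      then show ?thesis using h0(2) h' by auto
    qed
    have hc: "h \<in> carrier (powerset_maps X)"
      using mult.IH(2) car c by auto
    have "f0 \<otimes>\<^bsub>powerset_maps X\<^esub> ?c \<otimes>\<^bsub>powerset_maps X\<^esub> h
        = f0 \<otimes>\<^bsub>powerset_maps X\<^esub> (?c \<otimes>\<^bsub>powerset_maps X\<^esub> h)"
      using car[OF f0(1)] c hc by (simp add: M.m_assoc)
    then show ?case
      using f0(2) left[OF mult.IH(2)] left[OF ch] by auto
  qed
qed

lemma finite_full_Kuratowski_monoid: "finite (full_Kuratowski_monoid n X \<tau>)"
  using full_Kuratowski_monoid_subset finite_Kuratowski_monoid
  by (meson finite_UnI finite_imageI finite_subset)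

lemma card_full_Kuratowski_monoid_le:
  "card (full_Kuratowski_monoid n X \<tau>) \<le> 2 * Kuratowski_number n"
proof -
  let ?K = "Kuratowski_monoid n X \<tau>"
  let ?Kc = "(\<lambda>f. f \<otimes>\<^bsub>powerset_maps X\<^esub> complement_map X) ` ?K"
  have "card (full_Kuratowski_monoid n X \<tau>) \<le> card (?K \<union> ?Kc)"
    using full_Kuratowski_monoid_subset finite_Kuratowski_monoid by (intro card_mono) auto
  also have "\<dots> \<le> card ?K + card ?Kc" by (rule card_Un_le)
  also have "\<dots> \<le> 2 * card ?K"
    using card_image_le[OF finite_Kuratowski_monoid,
        of "\<lambda>f. f \<otimes>\<^bsub>powerset_maps X\<^esub> complement_map X"] by simp
  finally show ?thesis using card_Kuratowski_monoid_le by simp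
qed

end

section \<open>The cardinality bounds\<close>

theorem theorem1p1:
  fixes n :: nat and X :: "'a set" and \<tau> :: "nat \<Rightarrow> 'a topology"
  assumes "n \<noteq> 0"
    and "n_topological_space n X \<tau>"
  shows "finite (Kuratowski_monoid n X \<tau>)
           \<and> card (Kuratowski_monoid n X \<tau>) \<le> Kuratowski_number n
         \<and> finite (full_Kuratowski_monoid n X \<tau>)
           \<and> card (full_Kuratowski_monoid n X \<tau>) \<le> 2 * Kuratowski_number n"
  using finite_Kuratowski_monoid[OF assms] card_Kuratowski_monoid_le[OF assms]
    finite_full_Kuratowski_monoid[OF assms] card_full_Kuratowski_monoid_le[OF assms]
  by blast

end
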